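(* Let $n\ge1$ be an integer. For every real number $q>0$, each of the following polynomials in $x$ has only real roots: $$A_n^{\mathrm{inv}}(x,q)=\sum_{\pi\in\mathfrak{S}_n}x^{\operatorname{des}\pi}q^{\operatorname{inv}\pi},\qquad A_n^{\mathrm{comaj}}(x,q)=\sum_{\pi\in\mathfrak{S}_n}x^{\operatorname{des}\pi}q^{\operatorname{comaj}\pi},\qquad A_n^{\mathrm{maj}}(x,q)=\sum_{\pi\in\mathfrak{S}_n}x^{\operatorname{des}\pi}q^{\operatorname{maj}\pi}.$$
   Context: $\mathfrak{S}_n$ is the set of permutations of $\{1,\dots,n\}$. For $\pi=(\pi_1,\dots,\pi_n)\in\mathfrak{S}_n$: $\operatorname{Des}\pi=\{i\in\{1,\dots,n-1\}\mid\pi_i>\pi_{i+1}\}$, $\operatorname{des}\pi=|\operatorname{Des}\pi|$, $\operatorname{inv}\pi=|\{(i,j)\mid1\le i<j\le n,\ \pi_i>\pi_j\}|$, $\operatorname{maj}\pi=\sum_{j\in\operatorname{Des}\pi}j$, $\operatorname{comaj}\pi=\sum_{j\in\operatorname{Des}\pi}(n-j)$. A polynomial "has only real roots" if all its complex roots are real. *)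

theory Defs
  imports
    Complex_Main
    "HOL-Combinatorics.Permutations"
    "HOL-Computational_Algebra.Polynomial"
begin

text \<open>
  The symmetric group on \<open>{1..n}\<close> is \<open>{p. p permutes {1..n}}\<close>; each such \<open>p\<close> fixes every
  number outside \<open>{1..n}\<close>, so it is determined by the word \<open>p 1, ..., p n\<close>.
\<close>

definition Des :: "nat \<Rightarrow> (nat \<Rightarrow> nat) \<Rightarrow> nat set" where
  "Des n p = {i \<in> {1..<n}. p i > p (i + 1)}"

definition des :: "nat \<Rightarrow> (nat \<Rightarrow> nat) \<Rightarrow> nat" where
  "des n p = card (Des n p)"

definition inv_stat :: "nat \<Rightarrow> (nat \<Rightarrow> nat) \<Rightarrow> nat" where
  "inv_stat n p = card {(i, j). 1 \<le> i \<and> i < j \<and> j \<le> n \<and> p i > p j}"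

definition maj :: "nat \<Rightarrow> (nat \<Rightarrow> nat) \<Rightarrow> nat" where
  "maj n p = (\<Sum>j\<in>Des n p. j)"

definition comaj :: "nat \<Rightarrow> (nat \<Rightarrow> nat) \<Rightarrow> nat" where
  "comaj n p = (\<Sum>j\<in>Des n p. n - j)"

text \<open>The polynomials are in \<open>x\<close>, with the real number \<open>q\<close> a parameter.\<close>

definition A_inv :: "nat \<Rightarrow> real \<Rightarrow> real poly" where
  "A_inv n q = (\<Sum>p\<in>{p. p permutes {1..n}}. monom (q ^ inv_stat n p) (des n p))"

definition A_comaj :: "nat \<Rightarrow> real \<Rightarrow> real poly" where
  "A_comaj n q = (\<Sum>p\<in>{p. p permutes {1..n}}. monom (q ^ comaj n p) (des n p))"

definition A_maj :: "nat \<Rightarrow> real \<Rightarrow> real poly" where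
  "A_maj n q = (\<Sum>p\<in>{p. p permutes {1..n}}. monom (q ^ maj n p) (des n p))"

text \<open>Nonzero constants satisfy this predicate vacuously; the zero polynomial does not satisfy it.\<close>

definition only_real_roots :: "real poly \<Rightarrow> bool" where
  "only_real_roots f \<longleftrightarrow>
     (\<forall>z::complex. poly (map_poly complex_of_real f) z = 0 \<longrightarrow> z \<in> \<real>)"

end

theory Submission
  imports Defs
begin

text \<open>
  Group the permutations of \<open>{1..n}\<close> by their last letter \<open>l\<close> and let \<open>f l\<close> be the value at a
  point \<open>z\<close> of the open upper half plane of the corresponding part of the polynomial. Appending a
  last letter \<open>i\<close> replaces \<open>f\<close> by \<open>(\<Sum>l<i. f l) + z * (\<Sum>l\<ge>i. f l)\<close>, up to positive factors
  for \<open>inv\<close> and up to the substitution of \<open>q * z\<close> for \<open>z\<close> for \<open>comaj\<close>. This step preserves the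
  property that \<open>f n, ..., f 1, z * f n, ..., z * f 1\<close> are arranged counterclockwise, in the sense
  that \<open>Im (cnj (f k) * f l) > 0\<close> and \<open>Im (cnj (f l) * (z * f k)) \<ge> 0\<close> for \<open>l < k\<close>: a pointwise
  form of mutual interlacing, which follows from the bilinearity of \<open>Im (cnj a * b)\<close>. Numbers
  arranged in this way have a nonzero sum, so the polynomial does not vanish at \<open>z\<close>. Finally,
  \<open>maj = n * des - comaj\<close> turns the polynomial for \<open>maj\<close> into the one for \<open>comaj\<close> at \<open>1 / q\<close>.
\<close>

section \<open>Counterclockwise arrangements of complex numbers\<close>

text \<open>The determinant of \<open>a\<close> and \<open>b\<close> as plane vectors: positive
  exactly when \<open>b\<close> lies counterclockwise from \<open>a\<close> by an angle strictly
  between 0 and \<pi>.\<close>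

definition cross :: "complex \<Rightarrow> complex \<Rightarrow> real" where
  "cross a b = Im (cnj a * b)"

lemma cross_sum: "cross (sum f A) (sum g B) = (\<Sum>a\<in>A. \<Sum>b\<in>B. cross (f a) (g b))"
  by (simp only: cross_def cnj_sum sum_product Im_sum)

lemma cross_add_left: "cross (a + b) c = cross a c + cross b c"
  by (simp add: cross_def algebra_simps)

lemma cross_add_right: "cross a (b + c) = cross a b + cross a c"
  by (simp add: cross_def algebra_simps)

lemma cross_zero [simp]: "cross 0 a = 0" "cross a 0 = 0"
  by (simp_all add: cross_def)

lemma cross_refl [simp]: "cross a a = 0"
  by (simp add: cross_def)

lemma cross_anticomm: "cross a b = - cross b a"
  by (simp add: cross_def algebra_simps)

lemma cross_scale: "cross (z * a) (z * b) = (cmod z)\<^sup>2 * cross a b"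
  unfolding cross_def cmod_power2 by (simp add: algebra_simps power2_eq_square)

lemma cross_self: "cross a (z * a) = Im z * (cmod a)\<^sup>2"
  unfolding cross_def cmod_power2 by (simp add: algebra_simps power2_eq_square)

lemma cross_of_real:
  "cross (of_real c * a) b = c * cross a b" "cross a (of_real c * b) = c * cross a b"
  by (simp_all add: cross_def algebra_simps)

text \<open>Nonvanishing is a separate condition because there are no pairs for
  \<open>n = 1\<close>. The second inequality is weak because equality occurs:
  \<open>ccw_arranged_step\<close> at \<open>n = 1\<close> gives
  \<open>?g 1 = z * ?g 2\<close>.\<close>

definition ccw_arranged :: "complex \<Rightarrow> nat \<Rightarrow> (nat \<Rightarrow> complex) \<Rightarrow> bool" where
  "ccw_arranged z n f \<longleftrightarrow> (\<forall>l\<in>{1..n}. f l \<noteq> 0) \<and>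
     (\<forall>l\<in>{1..n}. \<forall>k\<in>{1..n}. l < k \<longrightarrow> cross (f k) (f l) > 0 \<and> cross (f l) (z * f k) \<ge> 0)"

text \<open>Every term after the first pairs positively with \<open>f i\<close>, hence so does the
  sum, unless it is the single term \<open>f i\<close>. General intervals serve
  \<open>ccw_arranged_step\<close>, where a middle block must not vanish.\<close>

lemma ccw_arranged_sum_nonzero:
  assumes f: "ccw_arranged z n f" and ij: "1 \<le> i" "i < j" "j \<le> Suc n"
  shows "sum f {i..<j} \<noteq> 0"
proof (cases "j = Suc i")
  case True
  then show ?thesis using f ij by (simp add: ccw_arranged_def)
next
  case False
  have split: "{i..<j} = insert i {Suc i..<j}"
    using ij by auto
  have "(\<Sum>k\<in>{Suc i..<j}. cross (f k) (f i)) > 0"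
    using False f ij by (intro sum_pos) (auto simp: ccw_arranged_def)
  then have "cross (sum f {i..<j}) (f i) > 0"
    using cross_sum[of f "{i..<j}" f "{i}"] by (simp add: split)
  then show ?thesis
    by auto
qed

text \<open>For \<open>i < j\<close>, the new values at \<open>i\<close> and \<open>j\<close> share
  the contribution \<open>z * A + C\<close> of the letters outside \<open>{i..<j}\<close> and differ
  only in having \<open>z * B\<close> or \<open>B\<close>. Bilinearity expands both pairings into
  nonnegative terms.\<close>

lemma ccw_arranged_step:
  fixes f :: "nat \<Rightarrow> complex"
  assumes f: "ccw_arranged z n f" and z: "Im z > 0" and n: "n \<ge> 1"
  shows "ccw_arranged z (Suc n) (\<lambda>i. sum f {1..<i} + z * sum f {i..n})" (is "ccw_arranged z _ ?g")
proof -
  have pairs: "cross (?g j) (?g i) > 0 \<and> cross (?g i) (z * ?g j) \<ge> 0"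
    if ij: "1 \<le> i" "i < j" "j \<le> Suc n" for i j
  proof -
    define A B C where "A = sum f {j..n}" and "B = sum f {i..<j}" and "C = sum f {1..<i}"
    have "{1..<j} = {1..<i} \<union> {i..<j}" "{i..n} = {i..<j} \<union> {j..n}"
      using ij by auto
    then have "sum f {1..<j} = C + B" "sum f {i..n} = B + A"
      by (simp_all only: A_def B_def C_def) (auto intro!: sum.union_disjoint)
    then have g: "?g j = (z * A + C) + B" "?g i = (z * A + C) + z * B"
      by (simp_all add: A_def C_def algebra_simps)
    have B0: "B \<noteq> 0"
      unfolding B_def using f ij by (rule ccw_arranged_sum_nonzero)
    have AB: "cross A B \<ge> 0" "cross B C \<ge> 0"
      using f ij unfolding A_def B_def C_def cross_sum
      by (auto intro!: sum_nonneg simp: ccw_arranged_def less_imp_le)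
    have zAB: "cross B (z * A) \<ge> 0" "cross C (z * B) \<ge> 0"
      using f ij unfolding A_def B_def C_def sum_distrib_left cross_sum
      by (auto intro!: sum_nonneg simp: ccw_arranged_def)
    \<comment> \<open>\<open>A\<close> is empty for \<open>j = Suc n\<close> and \<open>C\<close> is
      empty for \<open>i = 1\<close>, so strictness has to come from the middle block.\<close>
    have pos: "cross B (z * B) > 0"
      using B0 z by (simp add: cross_self)
    have "cross (?g j) (?g i) = (cmod z)\<^sup>2 * cross A B + cross C (z * B) + cross B (z * A)
        + cross B C + cross B (z * B)"
      unfolding g cross_scale[symmetric]
      by (simp add: cross_add_left cross_add_right cross_anticomm[of "z * A" C])
    also have "\<dots> > 0"
      using AB zAB pos by (intro add_nonneg_pos add_nonneg_nonneg) auto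
    finally have 1: "cross (?g j) (?g i) > 0" .
    \<comment> \<open>Here \<open>z * B\<close> occurs in both arguments and its pairing with itself
      vanishes, so no strictly positive term is guaranteed.\<close>
    have "cross (?g i) (z * ?g j) = cross (z * A + C) (z * (z * A + C))
        + (cmod z)\<^sup>2 * (cross A B + cross B (z * A) + cross B C) + cross C (z * B)"
      unfolding g by (simp add: cross_add_left cross_add_right cross_scale distrib_left)
    also have "\<dots> \<ge> 0"
      using AB zAB z unfolding cross_self[of "z * A + C"]
      by (intro add_nonneg_nonneg mult_nonneg_nonneg) auto
    finally show ?thesis using 1 by simp
  qed
  \<comment> \<open>As \<open>n \<ge> 1\<close>, there are at least two indices, and a strictly
    positive pairing with another value excludes 0.\<close>
  have "?g i \<noteq> 0" if "i \<in> {1..Suc n}" for i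
  proof (cases "i = 1")
    case True
    then have "cross (?g (Suc n)) (?g i) > 0"
      using pairs[of i "Suc n"] n by simp
    then show ?thesis by auto
  next
    case False
    then have "cross (?g i) (?g 1) > 0"
      using pairs[of 1 i] that by simp
    then show ?thesis by auto
  qed
  then show ?thesis
    using pairs unfolding ccw_arranged_def by auto
qed

text \<open>Positive real factors do not change the signs of pairings. The factors
  \<open>c i\<close> serve the recurrence for \<open>inv_stat\<close>, the change from
  \<open>z\<close> to \<open>w\<close> the one for \<open>comaj\<close>.\<close>

lemma ccw_arranged_scale:
  assumes f: "ccw_arranged z n f" and "r > 0" and w: "w = of_real r * z"
    and c: "\<And>i. i \<in> {1..n} \<Longrightarrow> c i > 0"
    and g: "\<And>i. i \<in> {1..n} \<Longrightarrow> g i = of_real (c i) * f i"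
  shows "ccw_arranged w n g"
proof -
  have "g i \<noteq> 0" if "i \<in> {1..n}" for i
    using that f c[OF that] g[OF that] by (simp add: ccw_arranged_def)
  moreover have "cross (g k) (g l) > 0 \<and> cross (g l) (w * g k) \<ge> 0"
    if "l \<in> {1..n}" "k \<in> {1..n}" "l < k" for l k
  proof -
    have "w * g k = of_real (r * c k) * (z * f k)"
      using that by (simp add: w g)
    then show ?thesis
      using that f c[of k] c[of l] \<open>r > 0\<close>
      by (simp only: g cross_of_real) (simp add: ccw_arranged_def)
  qed
  ultimately show ?thesis
    unfolding ccw_arranged_def by blast
qed

lemma ccw_arranged_one: "f 1 \<noteq> 0 \<Longrightarrow> ccw_arranged z 1 f"
  by (simp add: ccw_arranged_def)

section \<open>Appending a last letter to a permutation\<close>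

text \<open>For \<open>i\<close> in \<open>{1..Suc n}\<close> this is the cycle sending
  \<open>i\<close> to \<open>i + 1\<close>, and so on up to \<open>Suc n\<close>, which returns to
  \<open>i\<close>. Composed after a permutation of \<open>{1..n}\<close>, it appends the letter
  \<open>i\<close> and shifts the letters from \<open>i\<close> on up by one.\<close>

definition last_cycle :: "nat \<Rightarrow> nat \<Rightarrow> nat \<Rightarrow> nat" where
  "last_cycle n i k = (if k = Suc n then i else if i \<le> k \<and> k \<le> n then Suc k else k)"

lemma last_cycle_permutes:
  assumes "i \<in> {1..Suc n}"
  shows "last_cycle n i permutes {1..Suc n}"
proof (rule bij_imp_permutes)
  have inj: "inj_on (last_cycle n i) {1..Suc n}"
    using assms by (auto simp: inj_on_def last_cycle_def split: if_splits)
  moreover have "last_cycle n i ` {1..Suc n} \<subseteq> {1..Suc n}"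
    using assms by (auto simp: last_cycle_def)
  ultimately show "bij_betw (last_cycle n i) {1..Suc n} {1..Suc n}"
    using endo_inj_surj unfolding bij_betw_def by blast
  show "last_cycle n i x = x" if "x \<notin> {1..Suc n}" for x
    using that assms by (auto simp: last_cycle_def)
qed

text \<open>Composing with the inverse cycle undoes this: a permutation ending in \<open>i\<close>
  then fixes \<open>Suc n\<close>, so it permutes \<open>{1..n}\<close>.\<close>

lemma bij_betw_last_cycle_comp:
  assumes i: "i \<in> {1..Suc n}"
  shows "bij_betw (\<lambda>s. last_cycle n i \<circ> s) {s. s permutes {1..n}}
           {p. p permutes {1..Suc n} \<and> p (Suc n) = i}"
proof (rule bij_betw_byWitness[where f' = "\<lambda>p. inv (last_cycle n i) \<circ> p"])
  let ?c = "last_cycle n i"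
  note c = last_cycle_permutes[OF i]
  show "\<forall>s\<in>{s. s permutes {1..n}}. inv ?c \<circ> (?c \<circ> s) = s"
    by (simp add: o_assoc permutes_inv_o(2)[OF c])
  show "\<forall>p\<in>{p. p permutes {1..Suc n} \<and> p (Suc n) = i}. ?c \<circ> (inv ?c \<circ> p) = p"
    by (simp add: o_assoc permutes_inv_o(1)[OF c])
  show "(\<lambda>s. ?c \<circ> s) ` {s. s permutes {1..n}} \<subseteq> {p. p permutes {1..Suc n} \<and> p (Suc n) = i}"
  proof clarsimp
    fix s assume s: "s permutes {Suc 0..n}"
    then have "s permutes {1..Suc n}"
      by (auto intro: permutes_subset)
    moreover have "s (Suc n) = Suc n"
      using s by (auto simp: permutes_def)
    ultimately show "?c \<circ> s permutes {Suc 0..Suc n} \<and> ?c (s (Suc n)) = i"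
      using permutes_compose[OF _ c] by (simp add: last_cycle_def)
  qed
  show "(\<lambda>p. inv ?c \<circ> p) ` {p. p permutes {1..Suc n} \<and> p (Suc n) = i} \<subseteq> {s. s permutes {1..n}}"
  proof clarify
    fix p assume p: "p permutes {1..Suc n}" and i: "i = p (Suc n)"
    have "?c (Suc n) = p (Suc n)"
      by (simp add: last_cycle_def i)
    then have last: "inv ?c (p (Suc n)) = Suc n"
      by (metis c permutes_inverses(2))
    have "inv ?c \<circ> p permutes {1..Suc n}"
      using p permutes_inv[OF c] by (rule permutes_compose)
    then have "inv ?c \<circ> p permutes {1..n}"
      by (rule permutes_superset) (use last in \<open>auto simp: le_Suc_eq\<close>)
    then show "inv (last_cycle n (p (Suc n))) \<circ> p permutes {1..n}"
      by (simp add: i)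
  qed
qed

lemma last_cycle_less_iff:
  "a \<le> n \<Longrightarrow> b \<le> n \<Longrightarrow> last_cycle n i a < last_cycle n i b \<longleftrightarrow> a < b"
  by (auto simp: last_cycle_def)

lemma last_cycle_gt_iff: "a \<le> n \<Longrightarrow> i < last_cycle n i a \<longleftrightarrow> i \<le> a"
  by (auto simp: last_cycle_def)

context
  fixes n i :: nat and s :: "nat \<Rightarrow> nat"
  assumes s: "s permutes {1..n}"
begin

lemma permutes_le: "k \<le> n \<Longrightarrow> s k \<le> n"
  using permutes_in_image[OF s, of k] s by (cases "k = 0") (auto simp: permutes_def)

lemma last_cycle_comp_last: "(last_cycle n i \<circ> s) (Suc n) = i"
  using s by (simp add: last_cycle_def permutes_def)

text \<open>The shift keeps the relative order of the first \<open>n\<close> letters, so only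
  position \<open>n\<close> can become a descent.\<close>

lemma Des_last_cycle:
  assumes "n \<ge> 1"
  shows "Des (Suc n) (last_cycle n i \<circ> s) = Des n s \<union> (if i \<le> s n then {n} else {})"
proof (rule set_eqI)
  fix k
  show "k \<in> Des (Suc n) (last_cycle n i \<circ> s) \<longleftrightarrow> k \<in> Des n s \<union> (if i \<le> s n then {n} else {})"
  proof (cases "k = n")
    case True
    then show ?thesis
      using assms last_cycle_comp_last last_cycle_gt_iff permutes_le[of n] by (auto simp: Des_def)
  next
    case False
    then show ?thesis
      using permutes_le[of k] permutes_le[of "Suc k"] by (auto simp: Des_def last_cycle_less_iff)
  qed
qed

lemma des_last_cycle:
  assumes "n \<ge> 1"
  shows "des (Suc n) (last_cycle n i \<circ> s) = des n s + (if i \<le> s n then 1 else 0)"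
  unfolding des_def Des_last_cycle[OF assms] by (auto simp: Des_def)

text \<open>Each old descent gains weight 1 and a new descent at \<open>n\<close> has weight 1. This
  dependence on \<open>des\<close> is what replaces \<open>z\<close> by
  \<open>q * z\<close>.\<close>

lemma comaj_last_cycle:
  assumes "n \<ge> 1"
  shows "comaj (Suc n) (last_cycle n i \<circ> s) = comaj n s + des (Suc n) (last_cycle n i \<circ> s)"
proof -
  have "comaj (Suc n) (last_cycle n i \<circ> s) =
      (\<Sum>j\<in>Des (Suc n) (last_cycle n i \<circ> s). (n - j) + 1)"
    unfolding comaj_def by (rule sum.cong) (auto simp: Des_def)
  also have "\<dots> = (\<Sum>j\<in>Des (Suc n) (last_cycle n i \<circ> s). n - j) + des (Suc n) (last_cycle n i \<circ> s)"
    by (simp only: sum.distrib des_def card_eq_sum)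
  also have "(\<Sum>j\<in>Des (Suc n) (last_cycle n i \<circ> s). n - j) = comaj n s"
    unfolding Des_last_cycle[OF assms] comaj_def
    by (subst sum.union_disjoint) (auto simp: Des_def)
  finally show ?thesis .
qed

text \<open>The new inversions pair the last position with the positions of the old letters
  \<open>i, ..., n\<close>.\<close>

lemma inv_stat_last_cycle:
  assumes i: "i \<ge> 1"
  shows "inv_stat (Suc n) (last_cycle n i \<circ> s) = inv_stat n s + (Suc n - i)"
proof -
  let ?p = "last_cycle n i \<circ> s"
  let ?I = "{(a, b). 1 \<le> a \<and> a < b \<and> b \<le> n \<and> s a > s b}"
  let ?J = "{a \<in> {1..n}. i \<le> s a}"
  have "(1 \<le> a \<and> a < b \<and> b \<le> Suc n \<and> ?p a > ?p b) \<longleftrightarrow>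
      (1 \<le> a \<and> a < b \<and> b \<le> n \<and> s a > s b) \<or> (a \<in> ?J \<and> b = Suc n)" for a b
    using permutes_le[of a] permutes_le[of b] last_cycle_comp_last
    by (cases "b = Suc n") (auto simp: last_cycle_less_iff last_cycle_gt_iff)
  then have eq: "{(a, b). 1 \<le> a \<and> a < b \<and> b \<le> Suc n \<and> ?p a > ?p b} = ?I \<union> ?J \<times> {Suc n}"
    by auto
  have "?I \<subseteq> {1..n} \<times> {1..n}" by auto
  then have fin: "finite ?I" by (rule finite_subset) simp
  have "s ` ?J = {x \<in> s ` {1..n}. i \<le> x}"
    by auto
  also have "\<dots> = {i..n}"
    unfolding permutes_image[OF s] using i by auto
  finally have "s ` ?J = {i..n}" .
  moreover have "inj_on s ?J"
    using permutes_inj_on[OF s] .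
  ultimately have "card ?J = Suc n - i"
    by (metis card_image card_atLeastAtMost)
  then show ?thesis
    unfolding inv_stat_def eq using fin
    by (subst card_Un_disjoint) (auto simp: card_cartesian_product)
qed

end

section \<open>Recurrences by last letter\<close>

definition last_part :: "(nat \<Rightarrow> (nat \<Rightarrow> nat) \<Rightarrow> nat) \<Rightarrow> real \<Rightarrow> complex \<Rightarrow> nat \<Rightarrow> nat \<Rightarrow> complex" where
  "last_part stat q z n i =
     (\<Sum>p | p permutes {1..n} \<and> p n = i. z ^ des n p * of_real q ^ stat n p)"

lemma sum_permutes_by_last:
  fixes h :: "(nat \<Rightarrow> nat) \<Rightarrow> 'a::comm_monoid_add"
  assumes "n \<ge> 1"
  shows "(\<Sum>p | p permutes {1..n}. h p) = (\<Sum>i\<in>{1..n}. \<Sum>p | p permutes {1..n} \<and> p n = i. h p)"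
proof -
  have "(\<lambda>p. p n) ` {p. p permutes {1..n}} \<subseteq> {1..n}"
    using assms permutes_in_image by fastforce
  then show ?thesis
    using sum.group[of "{p. p permutes {1..n}}" "{1..n}" "\<lambda>p. p n" h]
    by (simp add: finite_permutations)
qed

text \<open>Covers both statistics: \<open>y = z\<close> and \<open>c = q ^ (Suc n - i)\<close> for
  \<open>inv_stat\<close>, \<open>y = q * z\<close> and \<open>c = 1\<close> for
  \<open>comaj\<close>.\<close>

lemma last_part_Suc:
  assumes n: "n \<ge> 1" and i: "i \<in> {1..Suc n}"
    and h: "\<And>s. s permutes {1..n} \<Longrightarrow>
      z ^ des (Suc n) (last_cycle n i \<circ> s) * of_real q ^ stat (Suc n) (last_cycle n i \<circ> s) =
      c * (if i \<le> s n then y else 1) * (y ^ des n s * of_real q ^ stat n s)"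
  shows "last_part stat q z (Suc n) i =
    c * (sum (last_part stat q y n) {1..<i} + y * sum (last_part stat q y n) {i..n})"
proof -
  have "last_part stat q z (Suc n) i = (\<Sum>s | s permutes {1..n}.
      c * (if i \<le> s n then y else 1) * (y ^ des n s * of_real q ^ stat n s))"
    unfolding last_part_def sum.reindex_bij_betw[OF bij_betw_last_cycle_comp[OF i], symmetric]
    by (rule sum.cong) (simp_all add: h)
  also have "\<dots> = (\<Sum>l\<in>{1..n}. c * (if i \<le> l then y else 1) * last_part stat q y n l)"
    unfolding sum_permutes_by_last[OF n] last_part_def sum_distrib_left
    by (intro sum.cong) auto
  also have "{1..n} = {1..<i} \<union> {i..n}"
    using i by auto
  also have "(\<Sum>l\<in>\<dots>. c * (if i \<le> l then y else 1) * last_part stat q y n l) =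
      (\<Sum>l\<in>{1..<i}. c * last_part stat q y n l) + (\<Sum>l\<in>{i..n}. c * y * last_part stat q y n l)"
    by (subst sum.union_disjoint) auto
  finally show ?thesis
    by (simp add: sum_distrib_left algebra_simps)
qed

lemma last_part_one: "last_part stat q z 1 1 = z ^ des 1 id * of_real q ^ stat 1 id"
proof -
  have "p permutes {1..1::nat} \<longleftrightarrow> p = id" for p
    by (simp add: permutes_sing)
  then have "{p. p permutes {1..1::nat} \<and> p 1 = 1} = {id}"
    by (simp only:) auto
  then show ?thesis
    unfolding last_part_def by (simp only:) simp
qed

lemma ccw_arranged_last_part_one:
  assumes "q > 0" "Im z > 0"
  shows "ccw_arranged z 1 (last_part stat q z 1)"
  by (intro ccw_arranged_one, unfold last_part_one) (use assms in auto)

lemma ccw_arranged_inv: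
  assumes "n \<ge> 1" "q > 0" "Im z > 0"
  shows "ccw_arranged z n (last_part inv_stat q z n)"
  using assms(1)
proof (induction n rule: dec_induct)
  case base
  then show ?case using assms ccw_arranged_last_part_one by simp
next
  case (step n)
  let ?f = "last_part inv_stat q z n"
  show ?case
  proof (rule ccw_arranged_scale[OF ccw_arranged_step[OF step.IH assms(3) step.hyps(1)]])
    show "(1::real) > 0" "z = of_real 1 * z"
      by simp_all
    fix i assume i: "i \<in> {1..Suc n}"
    then have "i \<ge> 1" by simp
    show "q ^ (Suc n - i) > 0"
      using assms(2) by simp
    show "last_part inv_stat q z (Suc n) i =
        of_real (q ^ (Suc n - i)) * (sum ?f {1..<i} + z * sum ?f {i..n})"
    proof (rule last_part_Suc[OF step.hyps(1) i])
      fix s assume s: "s permutes {1..n}"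
      show "z ^ des (Suc n) (last_cycle n i \<circ> s) *
          of_real q ^ inv_stat (Suc n) (last_cycle n i \<circ> s) =
          of_real (q ^ (Suc n - i)) * (if i \<le> s n then z else 1) *
          (z ^ des n s * of_real q ^ inv_stat n s)"
        by (simp only: des_last_cycle[OF s step.hyps(1)] inv_stat_last_cycle[OF s \<open>i \<ge> 1\<close>]
            power_add) simp
    qed
  qed
qed

lemma ccw_arranged_comaj:
  assumes "n \<ge> 1" "q > 0" "Im z > 0"
  shows "ccw_arranged z n (last_part comaj q z n)"
  using assms(1,3)
\<comment> \<open>The point must vary, since the induction hypothesis is applied at
  \<open>q * z\<close>.\<close>
proof (induction n arbitrary: z rule: dec_induct)
  case base
  then show ?case using assms ccw_arranged_last_part_one by simp
next
  case (step n)
  let ?y = "of_real q * z"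
  let ?f = "last_part comaj q ?y n"
  have y: "Im ?y > 0"
    using step assms by simp
  show ?case
  proof (rule ccw_arranged_scale[OF ccw_arranged_step[OF step.IH[OF y] y step.hyps(1)]])
    \<comment> \<open>The step gives an arrangement with respect to \<open>q * z\<close>; the factor
      \<open>1 / q\<close> leads back to \<open>z\<close>.\<close>
    show "1 / q > 0" "z = of_real (1 / q) * ?y"
      using assms(2) by simp_all
    show "(1::real) > 0"
      by simp
    fix i assume i: "i \<in> {1..Suc n}"
    show "last_part comaj q z (Suc n) i = of_real 1 * (sum ?f {1..<i} + ?y * sum ?f {i..n})"
    proof (rule last_part_Suc[OF step.hyps(1) i])
      fix s assume s: "s permutes {1..n}"
      show "z ^ des (Suc n) (last_cycle n i \<circ> s) *
          of_real q ^ comaj (Suc n) (last_cycle n i \<circ> s) =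
          of_real 1 * (if i \<le> s n then ?y else 1) * (?y ^ des n s * of_real q ^ comaj n s)"
        by (simp only: comaj_last_cycle[OF s step.hyps(1)] des_last_cycle[OF s step.hyps(1)]
            power_add power_mult_distrib) simp
    qed
  qed
qed

section \<open>From nonvanishing sums to real roots\<close>

lemma ccw_arranged_gf_nonzero:
  assumes "n \<ge> 1" "ccw_arranged z n (last_part stat q z n)"
  shows "(\<Sum>p | p permutes {1..n}. z ^ des n p * of_real q ^ stat n p) \<noteq> 0"
proof -
  have "sum (last_part stat q z n) {1..<Suc n} \<noteq> 0"
    using assms(1) by (intro ccw_arranged_sum_nonzero[OF assms(2)]) auto
  then show ?thesis
    unfolding sum_permutes_by_last[OF assms(1)] last_part_def atLeastLessThanSuc_atLeastAtMost .
qed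

lemma comaj_add_maj: "comaj n p + maj n p = n * des n p"
proof -
  have "comaj n p + maj n p = (\<Sum>j\<in>Des n p. n)"
    unfolding comaj_def maj_def sum.distrib[symmetric] by (rule sum.cong) (auto simp: Des_def)
  then show ?thesis by (simp add: des_def)
qed

lemma poly_gf:
  "poly (map_poly complex_of_real (\<Sum>p | p permutes {1..n}. monom (q ^ stat p) (des n p))) z =
    (\<Sum>p | p permutes {1..n}. z ^ des n p * of_real q ^ stat p)"
proof -
  have "map_poly complex_of_real (\<Sum>p\<in>S. monom (q ^ stat p) (des n p)) =
      (\<Sum>p\<in>S. monom (of_real (q ^ stat p)) (des n p))" for S
    by (intro poly_eqI) (simp add: coeff_map_poly coeff_sum of_real_sum if_distrib cong: if_cong)
  then show ?thesis
    by (simp add: poly_sum poly_monom mult.commute)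
qed

text \<open>The coefficients are real, so a root in the lower half plane would have its conjugate as
  a root in the upper one.\<close>

lemma only_real_rootsI:
  assumes "\<And>z. Im z > 0 \<Longrightarrow> poly (map_poly complex_of_real f) z \<noteq> 0"
  shows "only_real_roots f"
  unfolding only_real_roots_def
proof (intro allI impI)
  fix z assume z: "poly (map_poly complex_of_real f) z = 0"
  have "poly (map_poly complex_of_real f) (cnj z) = cnj (poly (map_poly complex_of_real f) z)"
    by (intro poly_cnj_real[symmetric]) (simp add: coeff_map_poly)
  then have "\<not> Im z > 0" "\<not> Im (cnj z) > 0"
    using assms[of z] assms[of "cnj z"] z by auto
  then show "z \<in> \<real>"
    by (simp add: complex_is_Real_iff)
qed

theorem theorem5p4:
  fixes n :: nat and q :: real
  assumes "n \<ge> 1" and "q > 0"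
  shows "only_real_roots (A_inv n q) \<and> only_real_roots (A_comaj n q) \<and> only_real_roots (A_maj n q)"
proof (intro conjI)
  show "only_real_roots (A_inv n q)"
    unfolding A_inv_def using assms
    by (intro only_real_rootsI)
      (simp only: poly_gf ccw_arranged_gf_nonzero ccw_arranged_inv not_False_eq_True)
  show "only_real_roots (A_comaj n q)"
    unfolding A_comaj_def using assms
    by (intro only_real_rootsI)
      (simp only: poly_gf ccw_arranged_gf_nonzero ccw_arranged_comaj not_False_eq_True)
  show "only_real_roots (A_maj n q)"
    unfolding A_maj_def
  proof (intro only_real_rootsI)
    fix z :: complex assume z: "Im z > 0"
    \<comment> \<open>By \<open>comaj_add_maj\<close>, the factor \<open>q ^ n\<close> per descent
      turns \<open>maj\<close> into \<open>comaj\<close> at \<open>1 / q\<close>. Being positive, it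
      keeps \<open>?w\<close> in the upper half plane.\<close>
    let ?w = "of_real (q ^ n) * z"
    have "z ^ des n p * of_real q ^ maj n p = ?w ^ des n p * of_real (1 / q) ^ comaj n p" for p
    proof -
      have "complex_of_real (q ^ n) ^ des n p = of_real q ^ comaj n p * of_real q ^ maj n p"
        by (simp only: of_real_power power_mult[symmetric] power_add[symmetric] comaj_add_maj)
      moreover have "complex_of_real q ^ comaj n p * of_real (1 / q) ^ comaj n p = 1"
        using assms by (simp add: power_mult_distrib[symmetric])
      ultimately show ?thesis
        by (simp only: power_mult_distrib) (simp add: mult_ac)
    qed
    moreover have "(\<Sum>p | p permutes {1..n}. ?w ^ des n p * of_real (1 / q) ^ comaj n p) \<noteq> 0"
      using assms z by (intro ccw_arranged_gf_nonzero ccw_arranged_comaj) auto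
    ultimately show "poly (map_poly complex_of_real
        (\<Sum>p | p permutes {1..n}. monom (q ^ maj n p) (des n p))) z \<noteq> 0"
      by (simp only: poly_gf not_False_eq_True)
  qed
qed

end
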